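(* Let $R$ be a commutative ring with identity and let $S$ be a multiplicatively closed subset of $R$. Then $R$ is an $S$-coherent ring if and only if every finitely presented $R$-module is $S$-coherent.
   Context: All modules are unitary. An $R$-module $M$ is called $S$-finite if there exist a finitely generated submodule $N$ of $M$ and an element $s\in S$ such that $sM\subseteq N\subseteq M$. An $R$-module $M$ is called $S$-finitely presented if there exists an exact sequence of $R$-modules $0\to K\to F\to M\to 0$ with $K$ $S$-finite and $F$ finitely generated free. An $R$-module $M$ is called $S$-coherent if it is finitely generated and every finitely generated submodule of $M$ is $S$-finitely presented. The ring $R$ is called an $S$-coherent ring if $R$ is $S$-coherent as an $R$-module, that is, every finitely generated ideal of $R$ is $S$-finitely presented. *)

theory Defs
  imports "Jordan_Normal_Form.Missing_VectorSpace"
begin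

definition fin_gen_module :: "('a, 'r) ring_scheme \<Rightarrow> ('a, 'm, 'x) module_scheme \<Rightarrow> bool" where
  "fin_gen_module R M \<longleftrightarrow>
     module R M \<and>
     (\<exists>A. finite A \<and> A \<subseteq> carrier M \<and> module.span R M A = carrier M)"

definition fin_gen_free_module :: "('a, 'r) ring_scheme \<Rightarrow> ('a, 'm, 'x) module_scheme \<Rightarrow> bool" where
  "fin_gen_free_module R F \<longleftrightarrow>
     module R F \<and>
     (\<exists>B. finite B \<and> B \<subseteq> carrier F \<and> module.span R F B = carrier F \<and> \<not> module.lin_dep R F B)"

definition short_exact ::
  "('a, 'r) ring_scheme \<Rightarrow> ('a, 'k, 'x) module_scheme \<Rightarrow> ('a, 'f, 'y) module_scheme \<Rightarrow>
   ('a, 'm, 'z) module_scheme \<Rightarrow> ('k \<Rightarrow> 'f) \<Rightarrow> ('f \<Rightarrow> 'm) \<Rightarrow> bool" where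
  "short_exact R K F M f g \<longleftrightarrow>
     mod_hom R K F f \<and> mod_hom R F M g \<and>
     inj_on f (carrier K) \<and>
     mod_hom.im K f = mod_hom.ker F M g \<and>
     mod_hom.im F g = carrier M"

definition S_finite :: "('a, 'r) ring_scheme \<Rightarrow> 'a set \<Rightarrow> ('a, 'm, 'x) module_scheme \<Rightarrow> bool" where
  "S_finite R S M \<longleftrightarrow>
     module R M \<and>
     (\<exists>N. \<exists>s\<in>S. submodule R N M \<and> fin_gen_module R (M\<lparr>carrier := N\<rparr>) \<and>
        (\<lambda>x. s \<odot>\<^bsub>M\<^esub> x) ` carrier M \<subseteq> N)"

text \<open>
  In a presentation \<open>0 \<rightarrow> K \<rightarrow> F \<rightarrow> M \<rightarrow> 0\<close> the modules \<open>K\<close> and \<open>F\<close> are taken with elements in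
  \<^typ>\<open>nat \<Rightarrow> 'a\<close>, where \<^typ>\<open>'a\<close> is the element type of the ring. This loses no generality: a
  free module of rank \<open>n\<close> is isomorphic to one on functions \<open>{..<n} \<rightarrow> R\<close>, and
  \<open>K\<close> is isomorphic to its image in \<open>F\<close>.
\<close>

definition finitely_presented ::
  "('a, 'r) ring_scheme \<Rightarrow> ('a, 'm, 'x) module_scheme \<Rightarrow> bool" where
  "finitely_presented R M \<longleftrightarrow>
     (\<exists>(K :: ('a, nat \<Rightarrow> 'a) module) (F :: ('a, nat \<Rightarrow> 'a) module) f g.
        short_exact R K F M f g \<and> fin_gen_module R K \<and> fin_gen_free_module R F)"

definition S_finitely_presented ::
  "('a, 'r) ring_scheme \<Rightarrow> 'a set \<Rightarrow> ('a, 'm, 'x) module_scheme \<Rightarrow> bool" where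
  "S_finitely_presented R S M \<longleftrightarrow>
     (\<exists>(K :: ('a, nat \<Rightarrow> 'a) module) (F :: ('a, nat \<Rightarrow> 'a) module) f g.
        short_exact R K F M f g \<and> S_finite R S K \<and> fin_gen_free_module R F)"

definition S_coherent_module ::
  "('a, 'r) ring_scheme \<Rightarrow> 'a set \<Rightarrow> ('a, 'm, 'x) module_scheme \<Rightarrow> bool" where
  "S_coherent_module R S M \<longleftrightarrow>
     fin_gen_module R M \<and>
     (\<forall>N. submodule R N M \<and> fin_gen_module R (M\<lparr>carrier := N\<rparr>)
        \<longrightarrow> S_finitely_presented R S (M\<lparr>carrier := N\<rparr>))"

definition self_module :: "('a, 'r) ring_scheme \<Rightarrow> ('a, 'a) module" where
  "self_module R =
     \<lparr>carrier = carrier R, mult = mult R, one = one R, zero = zero R, add = add R, smult = mult R\<rparr>"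

definition S_coherent_ring :: "('a, 'r) ring_scheme \<Rightarrow> 'a set \<Rightarrow> bool" where
  "S_coherent_ring R S \<longleftrightarrow> S_coherent_module R S (self_module R)"

text \<open>
  A formula cannot quantify over the element types of modules, so ``every finitely presented
  \<open>R\<close>-module'' is rendered by two quantifiers: one over the modules with elements in
  \<^typ>\<open>(nat \<Rightarrow> 'a) set\<close>, and one over the modules with elements in an arbitrary type \<^typ>\<open>'m\<close>,
  left free. The former type contains an isomorphic copy of every finitely presented \<open>R\<close>-module,
  namely a quotient of some \<open>R\<^sup>n\<close>, whose elements are cosets; the latter makes the statement apply
  directly to modules of any element type.
\<close>

end

theory Submission
  imports Defs
begin

text \<open>
  \<open>S\<close>-finite presentation is tested on one generating family: by Schanuel's lemma, a module generated
  by \<open>x\<^sub>1, \<dots>, x\<^sub>n\<close> is \<open>S\<close>-finitely presented iff the syzygies of \<open>x\<close>, a submodule of \<open>R\<^sup>n\<close>, are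
  \<open>S\<close>-finite. Hence a finitely generated module is \<open>S\<close>-coherent iff all its finite families have
  \<open>S\<close>-finite syzygies. This property passes from \<open>R\<close> to \<open>R\<^sup>n\<close> by induction: multiplying by some
  \<open>s \<in> S\<close>, one writes a syzygy of the last coordinates through finitely many such syzygies, which
  turns the remaining condition into a syzygy in \<open>R\<^sup>n\<^sup>-\<^sup>1\<close>; here \<open>S\<close> must be closed under products.
  It passes to \<open>R\<^sup>n / K\<close> with \<open>K\<close> generated by \<open>w\<close>, because syzygies in the quotient are truncations
  of syzygies of the family of lifts extended by \<open>w\<close>. Conversely \<open>R\<close> itself is finitely presented.
\<close>

subsection \<open>Linear combinations and syzygies of finite families\<close>

text \<open>Concrete free module of rank \<open>n\<close>. Its vectors are extensional functions on
  \<open>{..<n}\<close>: two of them are equal once they agree below \<open>n\<close>, and arbitrary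
  coefficient functions are cut down with \<open>restrict\<close>.\<close>

abbreviation Rn :: "('a, 'r) ring_scheme \<Rightarrow> nat \<Rightarrow> ('a, nat \<Rightarrow> 'a) module" where
  "Rn R n \<equiv> ring.func_space R {..<n}"

text \<open>Recursive rather than \<^const>\<open>finsum\<close>, so that it does not depend on the carrier of \<open>M\<close>.\<close>

primrec comb :: "('a, 'm, 'x) module_scheme \<Rightarrow> (nat \<Rightarrow> 'a) \<Rightarrow> (nat \<Rightarrow> 'm) \<Rightarrow> nat \<Rightarrow> 'm" where
  "comb M c x 0 = \<zero>\<^bsub>M\<^esub>"
| "comb M c x (Suc n) = comb M c x n \<oplus>\<^bsub>M\<^esub> c n \<odot>\<^bsub>M\<^esub> x n"

definition combs :: "('a, 'r) ring_scheme \<Rightarrow> ('a, 'm, 'x) module_scheme \<Rightarrow> (nat \<Rightarrow> 'm) \<Rightarrow> nat \<Rightarrow> 'm set" where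
  "combs R M x n = (\<lambda>c. comb M c x n) ` carrier (Rn R n)"

definition syz :: "('a, 'r) ring_scheme \<Rightarrow> ('a, 'm, 'x) module_scheme \<Rightarrow> (nat \<Rightarrow> 'm) \<Rightarrow> nat \<Rightarrow> (nat \<Rightarrow> 'a) set" where
  "syz R M x n = {c \<in> carrier (Rn R n). comb M c x n = \<zero>\<^bsub>M\<^esub>}"

text \<open>Refers to a finite family rather than a finitely generated submodule, so that witnesses
  can be built by concatenating and substituting families. The family may be empty
  (\<open>l = 0\<close>).\<close>

definition S_finite_in :: "('a, 'r) ring_scheme \<Rightarrow> 'a set \<Rightarrow> ('a, 'm, 'x) module_scheme \<Rightarrow> 'm set \<Rightarrow> bool" where
  "S_finite_in R S M N \<longleftrightarrow>
     (\<exists>s\<in>S. \<exists>w l. w \<in> {..<l} \<rightarrow> N \<and> (\<forall>v\<in>N. s \<odot>\<^bsub>M\<^esub> v \<in> combs R M w l))"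

text \<open>The working form of \<open>S\<close>-coherence: it mentions neither submodules nor
  presentations, and \<open>S_coherent_module_iff\<close> shows that it is the right condition on
  finitely generated modules.\<close>

definition syz_S_fin :: "('a, 'r) ring_scheme \<Rightarrow> 'a set \<Rightarrow> ('a, 'm, 'x) module_scheme \<Rightarrow> bool" where
  "syz_S_fin R S M \<longleftrightarrow>
     (\<forall>n x. x \<in> {..<n} \<rightarrow> carrier M \<longrightarrow> S_finite_in R S (Rn R n) (syz R M x n))"

lemma comb_cong:
  "(\<And>i. i < n \<Longrightarrow> c i = d i) \<Longrightarrow> (\<And>i. i < n \<Longrightarrow> x i = y i) \<Longrightarrow> comb M c x n = comb M d y n"
  by (induction n) auto

lemma comb_carrier_update [simp]: "comb (M\<lparr>carrier := N\<rparr>) c x n = comb M c x n"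
  by (induction n) auto

lemma combs_carrier_update [simp]: "combs R (M\<lparr>carrier := N\<rparr>) x n = combs R M x n"
  by (simp add: combs_def)

lemma syz_carrier_update [simp]: "syz R (M\<lparr>carrier := N\<rparr>) x n = syz R M x n"
  by (simp add: syz_def)

lemma mod_homI:
  assumes "module R M" "module R N"
    and "\<And>x. x \<in> carrier M \<Longrightarrow> f x \<in> carrier N"
    and "\<And>x y. x \<in> carrier M \<Longrightarrow> y \<in> carrier M \<Longrightarrow> f (x \<oplus>\<^bsub>M\<^esub> y) = f x \<oplus>\<^bsub>N\<^esub> f y"
    and "\<And>r x. r \<in> carrier R \<Longrightarrow> x \<in> carrier M \<Longrightarrow> f (r \<odot>\<^bsub>M\<^esub> x) = r \<odot>\<^bsub>N\<^esub> f x"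
  shows "mod_hom R M N f"
  using assms by (auto simp: mod_hom_def mod_hom_axioms_def module_hom_def)

section \<open>Coordinates and truncations in the free modules \<open>Rn R n\<close>\<close>

context cring
begin

lemma Rn_carrier: "carrier (Rn R n) = {..<n} \<rightarrow>\<^sub>E carrier R"
  by (simp add: func_space_def)

lemma Rn_module: "module R (Rn R n)"
  by (rule func_space_is_module)

lemma Rn_coeff: "c \<in> carrier (Rn R n) \<Longrightarrow> i < n \<Longrightarrow> c i \<in> carrier R"
  by (auto simp: Rn_carrier)

lemma Rn_apply:
  "i < n \<Longrightarrow> (c \<oplus>\<^bsub>Rn R n\<^esub> d) i = c i \<oplus> d i"
  "i < n \<Longrightarrow> (r \<odot>\<^bsub>Rn R n\<^esub> c) i = r \<otimes> c i"
  "i < n \<Longrightarrow> \<zero>\<^bsub>Rn R n\<^esub> i = \<zero>"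
  by (auto simp: func_space_def)

lemma Rn_ext:
  assumes "c \<in> carrier (Rn R n)" "d \<in> carrier (Rn R n)" "\<And>i. i < n \<Longrightarrow> c i = d i"
  shows "c = d"
  using assms unfolding Rn_carrier by (intro PiE_ext[where k="{..<n}"]) auto

lemma restrict_in_Rn: "(\<And>i. i < n \<Longrightarrow> c i \<in> carrier R) \<Longrightarrow> restrict c {..<n} \<in> carrier (Rn R n)"
  by (auto simp: Rn_carrier)

definition unit :: "nat \<Rightarrow> nat \<Rightarrow> nat \<Rightarrow> 'a" where
  "unit n j = (\<lambda>i\<in>{..<n}. if i = j then \<one> else \<zero>)"

lemma unit_in_Rn: "unit n j \<in> carrier (Rn R n)"
  unfolding unit_def by (rule restrict_in_Rn) auto

lemma self_module_module: "module R (self_module R)"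
  by (rule module_criteria)
    (auto simp: self_module_def m_assoc l_distr r_distr is_cring a_ac intro: r_neg)

lemma Rn_eval_hom:
  assumes "i < n"
  shows "mod_hom R (Rn R n) (self_module R) (\<lambda>c. c i)"
  by (rule mod_homI[OF Rn_module self_module_module])
    (use assms in \<open>auto simp: self_module_def Rn_apply Rn_coeff\<close>)

lemma Rn_restrict_hom:
  assumes "m \<le> n"
  shows "mod_hom R (Rn R n) (Rn R m) (\<lambda>c. restrict c {..<m})"
proof (rule mod_homI[OF Rn_module Rn_module])
  fix c d assume c: "c \<in> carrier (Rn R n)" and d: "d \<in> carrier (Rn R n)"
  have *: "restrict v {..<m} \<in> carrier (Rn R m)" if "v \<in> carrier (Rn R n)" for v
    using that assms by (intro restrict_in_Rn) (auto intro: Rn_coeff)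
  show "restrict c {..<m} \<in> carrier (Rn R m)" by (rule *[OF c])
  interpret n: module R "Rn R n" by (rule Rn_module)
  interpret m: module R "Rn R m" by (rule Rn_module)
  show "restrict (c \<oplus>\<^bsub>Rn R n\<^esub> d) {..<m} = restrict c {..<m} \<oplus>\<^bsub>Rn R m\<^esub> restrict d {..<m}"
    by (rule Rn_ext[of _ m]) (use c d assms in \<open>auto intro!: * simp: Rn_apply\<close>)
next
  fix r c assume c: "c \<in> carrier (Rn R n)" and r: "r \<in> carrier R"
  have *: "restrict v {..<m} \<in> carrier (Rn R m)" if "v \<in> carrier (Rn R n)" for v
    using that assms by (intro restrict_in_Rn) (auto intro: Rn_coeff)
  interpret n: module R "Rn R n" by (rule Rn_module)
  interpret m: module R "Rn R m" by (rule Rn_module)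
  show "restrict (r \<odot>\<^bsub>Rn R n\<^esub> c) {..<m} = r \<odot>\<^bsub>Rn R m\<^esub> restrict c {..<m}"
    by (rule Rn_ext[of _ m]) (use c r assms in \<open>auto intro!: * simp: Rn_apply\<close>)
qed

end

section \<open>Linearity of combinations and the submodules they form\<close>

context mod_hom
begin

lemma hom_comb:
  assumes "c \<in> {..<n} \<rightarrow> carrier R" "x \<in> {..<n} \<rightarrow> carrier M"
  shows "comb M c x n \<in> carrier M \<and> f (comb M c x n) = comb N c (\<lambda>i. f (x i)) n"
  using assms by (induction n) (auto simp: lessThan_Suc)

end

context module
begin

lemma comb_closed:
  assumes "c \<in> {..<n} \<rightarrow> carrier R" "x \<in> {..<n} \<rightarrow> carrier M"
  shows "comb M c x n \<in> carrier M"
  using assms by (induction n) (auto simp: lessThan_Suc)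

lemma comb_in_submodule:
  assumes "submodule R N M" "c \<in> {..<n} \<rightarrow> carrier R" "x \<in> {..<n} \<rightarrow> N"
  shows "comb M c x n \<in> N"
proof -
  interpret submodule R N M by fact
  show ?thesis
    using assms(2,3) by (induction n) (auto simp: lessThan_Suc)
qed

lemma comb_add:
  assumes "c \<in> {..<n} \<rightarrow> carrier R" "d \<in> {..<n} \<rightarrow> carrier R" "x \<in> {..<n} \<rightarrow> carrier M"
  shows "comb M (\<lambda>i. c i \<oplus> d i) x n = comb M c x n \<oplus>\<^bsub>M\<^esub> comb M d x n"
  using assms
proof (induction n)
  case (Suc n)
  then have "comb M c x n \<in> carrier M" "comb M d x n \<in> carrier M"
    "c n \<odot>\<^bsub>M\<^esub> x n \<in> carrier M" "d n \<odot>\<^bsub>M\<^esub> x n \<in> carrier M"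
    by (auto intro!: comb_closed simp: lessThan_Suc)
  then show ?case
    using Suc by (auto simp: lessThan_Suc smult_l_distr M.a_ac)
qed auto

lemma comb_smult:
  assumes "r \<in> carrier R" "c \<in> {..<n} \<rightarrow> carrier R" "x \<in> {..<n} \<rightarrow> carrier M"
  shows "comb M (\<lambda>i. r \<otimes> c i) x n = r \<odot>\<^bsub>M\<^esub> comb M c x n"
  using assms
proof (induction n)
  case (Suc n)
  then have "comb M c x n \<in> carrier M" "c n \<odot>\<^bsub>M\<^esub> x n \<in> carrier M"
    by (auto intro!: comb_closed simp: lessThan_Suc)
  then show ?case
    using Suc by (auto simp: lessThan_Suc smult_r_distr smult_assoc1)
qed auto

lemma comb_mod_hom:
  assumes x: "x \<in> {..<n} \<rightarrow> carrier M"
  shows "mod_hom R (Rn R n) M (\<lambda>c. comb M c x n)"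
proof (rule mod_homI[OF Rn_module])
  show "module R M" ..
next
  fix c assume c: "c \<in> carrier (Rn R n)"
  show "comb M c x n \<in> carrier M"
    using c x by (intro comb_closed) (auto simp: Rn_carrier)
  fix d assume d: "d \<in> carrier (Rn R n)"
  have "comb M (c \<oplus>\<^bsub>Rn R n\<^esub> d) x n = comb M (\<lambda>i. c i \<oplus> d i) x n"
    by (rule comb_cong) (auto simp: Rn_apply)
  also have "\<dots> = comb M c x n \<oplus>\<^bsub>M\<^esub> comb M d x n"
    using c d x by (intro comb_add) (auto simp: Rn_carrier)
  finally show "comb M (c \<oplus>\<^bsub>Rn R n\<^esub> d) x n = comb M c x n \<oplus>\<^bsub>M\<^esub> comb M d x n" .
next
  fix r c assume r: "r \<in> carrier R" and c: "c \<in> carrier (Rn R n)"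
  have "comb M (r \<odot>\<^bsub>Rn R n\<^esub> c) x n = comb M (\<lambda>i. r \<otimes> c i) x n"
    by (rule comb_cong) (auto simp: Rn_apply)
  also have "\<dots> = r \<odot>\<^bsub>M\<^esub> comb M c x n"
    using r c x by (intro comb_smult) (auto simp: Rn_carrier)
  finally show "comb M (r \<odot>\<^bsub>Rn R n\<^esub> c) x n = r \<odot>\<^bsub>M\<^esub> comb M c x n" .
qed

lemma combs_submodule: "x \<in> {..<n} \<rightarrow> carrier M \<Longrightarrow> submodule R (combs R M x n) M"
  using mod_hom.im_is_submodule[OF comb_mod_hom] by (simp add: combs_def mod_hom.im_def[OF comb_mod_hom])

lemma syz_submodule: "x \<in> {..<n} \<rightarrow> carrier M \<Longrightarrow> submodule R (syz R M x n) (Rn R n)"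
  using mod_hom.ker_is_submodule[OF comb_mod_hom] by (simp add: syz_def mod_hom.ker_def[OF comb_mod_hom])

lemma comb_in_combs:
  assumes "c \<in> {..<n} \<rightarrow> carrier R"
  shows "comb M c x n \<in> combs R M x n"
  unfolding combs_def
  by (rule image_eqI[where x="restrict c {..<n}"]) (use assms in \<open>auto intro!: comb_cong simp: Rn_carrier\<close>)

lemma combs_subset_submodule:
  "submodule R N M \<Longrightarrow> x \<in> {..<n} \<rightarrow> N \<Longrightarrow> combs R M x n \<subseteq> N"
  by (auto simp: combs_def Rn_carrier intro!: comb_in_submodule)

lemma comb_eq_zero:
  assumes "\<And>i. i < n \<Longrightarrow> c i \<odot>\<^bsub>M\<^esub> x i = \<zero>\<^bsub>M\<^esub>"
  shows "comb M c x n = \<zero>\<^bsub>M\<^esub>"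
  using assms by (induction n) auto

lemma comb_single:
  assumes "j < n" "c j \<in> carrier R" "x j \<in> carrier M"
    and "\<And>i. i < n \<Longrightarrow> i \<noteq> j \<Longrightarrow> c i \<odot>\<^bsub>M\<^esub> x i = \<zero>\<^bsub>M\<^esub>"
  shows "comb M c x n = c j \<odot>\<^bsub>M\<^esub> x j"
  using assms
proof (induction n)
  case (Suc n)
  show ?case
  proof (cases "j = n")
    case True
    then have "comb M c x n = \<zero>\<^bsub>M\<^esub>"
      using Suc.prems by (intro comb_eq_zero) auto
    then show ?thesis using True Suc.prems by simp
  next
    case False
    then have "comb M c x n = c j \<odot>\<^bsub>M\<^esub> x j"
      using Suc by auto
    then show ?thesis using False Suc.prems by simp
  qed
qed auto

lemma comb_unit:
  assumes "j < n" "x \<in> {..<n} \<rightarrow> carrier M"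
  shows "comb M (unit n j) x n = x j"
proof -
  have "comb M (unit n j) x n = unit n j j \<odot>\<^bsub>M\<^esub> x j"
    by (rule comb_single) (use assms in \<open>auto simp: unit_def Pi_iff\<close>)
  moreover have "unit n j j = \<one>" "x j \<in> carrier M" using assms by (auto simp: unit_def)
  ultimately show ?thesis by simp
qed

lemma in_combs: "j < n \<Longrightarrow> x \<in> {..<n} \<rightarrow> carrier M \<Longrightarrow> x j \<in> combs R M x n"
  unfolding combs_def by (rule image_eqI[where x="unit n j"]) (auto simp: comb_unit unit_in_Rn)

text \<open>Serves two concatenations: of the two kinds of generators in Schanuel's lemma, and of
  lifts with generators of a kernel in a quotient.\<close>

lemma comb_append:
  assumes "c \<in> {..<m} \<rightarrow> carrier R" "x \<in> {..<m} \<rightarrow> carrier M"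
    "d \<in> {..<l} \<rightarrow> carrier R" "y \<in> {..<l} \<rightarrow> carrier M"
  shows "comb M (\<lambda>i. if i < m then c i else d (i - m)) (\<lambda>i. if i < m then x i else y (i - m)) (m + l)
    = comb M c x m \<oplus>\<^bsub>M\<^esub> comb M d y l"
  using assms(3,4)
proof (induction l)
  case 0
  have "comb M (\<lambda>i. if i < m then c i else d (i - m)) (\<lambda>i. if i < m then x i else y (i - m)) m = comb M c x m"
    by (rule comb_cong) auto
  then show ?case using comb_closed[OF assms(1,2)] by simp
next
  case (Suc l)
  have "comb M d y l \<in> carrier M" "comb M c x m \<in> carrier M"
    using Suc.prems assms by (auto intro!: comb_closed)
  then show ?case
    using Suc by (simp add: lessThan_Suc M.a_assoc)
qed

section \<open>Finite generation and \<open>S\<close>-finiteness expressed by families\<close>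

lemma span_image_eq_combs:
  assumes "x \<in> {..<n} \<rightarrow> carrier M"
  shows "span (x ` {..<n}) = combs R M x n"
proof
  show "span (x ` {..<n}) \<subseteq> combs R M x n"
    using assms by (intro span_is_subset combs_submodule) (auto intro: in_combs)
  have "x ` {..<n} \<subseteq> carrier M" using assms by auto
  then show "combs R M x n \<subseteq> span (x ` {..<n})"
    by (intro combs_subset_submodule span_is_submodule) (use in_own_span in auto)
qed

lemma fin_gen_module_iff:
  "fin_gen_module R M \<longleftrightarrow> (\<exists>x n. x \<in> {..<n} \<rightarrow> carrier M \<and> carrier M = combs R M x n)"
proof
  assume "fin_gen_module R M"
  then obtain A where A: "finite A" "A \<subseteq> carrier M" "span A = carrier M"
    by (auto simp: fin_gen_module_def)
  obtain n :: nat and x where x: "A = x ` {i. i < n}"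
    using finite_imp_nat_seg_image_inj_on[OF A(1)] by auto
  have "x \<in> {..<n} \<rightarrow> carrier M" using x A by auto
  moreover have "span A = combs R M x n"
    using span_image_eq_combs[OF calculation] x by (simp add: lessThan_def)
  ultimately show "\<exists>x n. x \<in> {..<n} \<rightarrow> carrier M \<and> carrier M = combs R M x n"
    using A by auto
next
  assume "\<exists>x n. x \<in> {..<n} \<rightarrow> carrier M \<and> carrier M = combs R M x n"
  then obtain x n where x: "x \<in> {..<n} \<rightarrow> carrier M" "carrier M = combs R M x n" by blast
  have "module R M" ..
  moreover have "x ` {..<n} \<subseteq> carrier M" using x by auto
  moreover have "span (x ` {..<n}) = carrier M" using x span_image_eq_combs by metis
  ultimately show "fin_gen_module R M"
    unfolding fin_gen_module_def by blast
qed

lemma fin_gen_submodule_iff: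
  assumes "submodule R N M"
  shows "fin_gen_module R (M\<lparr>carrier := N\<rparr>) \<longleftrightarrow> (\<exists>x n. x \<in> {..<n} \<rightarrow> N \<and> N = combs R M x n)"
  using module.fin_gen_module_iff[OF submodule_is_module[OF assms]] by simp

text \<open>The submodule \<open>N\<close> of the definition is the span of its finite family, so
  only the family and the multiplier have to be recorded.\<close>

lemma S_finite_iff: "S_finite R S M \<longleftrightarrow> S_finite_in R S M (carrier M)"
proof
  assume "S_finite R S M"
  then obtain N s where N: "s \<in> S" "submodule R N M" "fin_gen_module R (M\<lparr>carrier := N\<rparr>)"
    "(\<lambda>x. s \<odot>\<^bsub>M\<^esub> x) ` carrier M \<subseteq> N"
    unfolding S_finite_def by blast
  then obtain w l where w: "w \<in> {..<l} \<rightarrow> N" "N = combs R M w l"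
    using fin_gen_submodule_iff by blast
  have "N \<subseteq> carrier M" using N(2) by (simp add: submodule_def)
  then show "S_finite_in R S M (carrier M)"
    unfolding S_finite_in_def using N w by (intro bexI[of _ s] exI[of _ w] exI[of _ l]) auto
next
  assume "S_finite_in R S M (carrier M)"
  then obtain s w l where w: "s \<in> S" "w \<in> {..<l} \<rightarrow> carrier M" "\<forall>v\<in>carrier M. s \<odot>\<^bsub>M\<^esub> v \<in> combs R M w l"
    unfolding S_finite_in_def by blast
  have sub: "submodule R (combs R M w l) M"
    by (rule combs_submodule[OF w(2)])
  have "fin_gen_module R (M\<lparr>carrier := combs R M w l\<rparr>)"
    unfolding fin_gen_submodule_iff[OF sub] using w(2) in_combs by blast
  moreover have "module R M" ..
  ultimately show "S_finite R S M"
    unfolding S_finite_def using sub w by blast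
qed

end

text \<open>Checked coordinatewise: evaluation at \<open>i\<close> is linear, and among the
  \<open>i\<close>-th entries of the unit vectors only that of \<open>unit n i\<close> can be
  nonzero.\<close>

lemma (in cring) comb_Rn_unit:
  assumes c: "c \<in> carrier (Rn R n)"
  shows "comb (Rn R n) c (unit n) n = c"
proof (rule Rn_ext)
  interpret P: module R "Rn R n" by (rule Rn_module)
  interpret self: module R "self_module R" by (rule self_module_module)
  have u: "unit n \<in> {..<n} \<rightarrow> carrier (Rn R n)" by (auto intro: unit_in_Rn)
  have c': "c \<in> {..<n} \<rightarrow> carrier R" using c by (auto simp: Rn_carrier)
  show "comb (Rn R n) c (unit n) n \<in> carrier (Rn R n)"
    by (rule P.comb_closed[OF c' u])
  show "c \<in> carrier (Rn R n)" by fact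
  fix i assume i: "i < n"
  interpret ev: mod_hom R "Rn R n" "self_module R" "\<lambda>c. c i"
    by (rule Rn_eval_hom[OF i])
  have "comb (Rn R n) c (unit n) n i = comb (self_module R) c (\<lambda>j. unit n j i) n"
    using ev.hom_comb[OF c' u] by simp
  also have "\<dots> = c i \<odot>\<^bsub>self_module R\<^esub> unit n i i"
    by (rule self.comb_single) (use i c' in \<open>auto simp: unit_def self_module_def Pi_iff\<close>)
  also have "\<dots> = c i"
    using i c' by (auto simp: unit_def self_module_def Pi_iff)
  finally show "comb (Rn R n) c (unit n) n i = c i" .
qed

subsection \<open>Presentations and syzygies\<close>

lemma mod_hom_compose:
  assumes "mod_hom R M N f" "mod_hom R N P g"
  shows "mod_hom R M P (\<lambda>x. g (f x))"
proof -
  interpret f: mod_hom R M N f by fact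
  interpret g: mod_hom R N P g by fact
  show ?thesis
    by (rule mod_homI) (simp_all add: f.M.module_axioms g.N.module_axioms)
qed

lemma mod_hom_diff:
  assumes "mod_hom R M N f" "mod_hom R M N g"
  shows "mod_hom R M N (\<lambda>x. f x \<ominus>\<^bsub>N\<^esub> g x)"
proof -
  interpret M: module R M using assms(1) by (simp add: mod_hom_def)
  interpret N: module R N using assms(1) by (simp add: mod_hom_def)
  interpret f: mod_hom R M N f by fact
  interpret g: mod_hom R M N g by fact
  show ?thesis
    by (rule mod_homI)
      (simp_all add: M.module_axioms N.module_axioms a_minus_def N.M.minus_add N.M.a_ac
        N.smult_r_distr N.smult_r_minus)
qed

text \<open>\<open>lincomb\<close> sums over a set of vectors, so \<open>b\<close> has to be
  injective for each index to contribute its own summand.\<close>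

lemma (in module) lincomb_image_eq_comb:
  assumes "inj_on b {..<m}" "b \<in> {..<m} \<rightarrow> carrier M" "a \<in> b ` {..<m} \<rightarrow> carrier R"
  shows "lincomb a (b ` {..<m}) = comb M (\<lambda>i. a (b i)) b m"
  using assms
proof (induction m)
  case 0
  then show ?case by (simp add: lincomb_def)
next
  case (Suc m)
  have a: "a \<in> b ` {..<m} \<union> {b m} \<rightarrow> carrier R"
    using Suc.prems by (auto simp: lessThan_Suc)
  have b: "b ` {..<m} \<subseteq> carrier M" "b m \<in> carrier M" "b m \<notin> b ` {..<m}"
    using Suc.prems by (auto simp: inj_on_def lessThan_Suc)
  have "lincomb a (b ` {..<m} \<union> {b m}) = a (b m) \<odot>\<^bsub>M\<^esub> b m \<oplus>\<^bsub>M\<^esub> lincomb a (b ` {..<m})"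
    by (rule lincomb_insert[OF _ b(1) a b(3,2)]) simp
  also have "lincomb a (b ` {..<m}) = comb M (\<lambda>i. a (b i)) b m"
    using Suc by (auto simp: inj_on_def lessThan_Suc)
  also have "a (b m) \<odot>\<^bsub>M\<^esub> b m \<oplus>\<^bsub>M\<^esub> \<dots> = comb M (\<lambda>i. a (b i)) b (Suc m)"
  proof -
    have "comb M (\<lambda>i. a (b i)) b m \<in> carrier M"
      using a b by (intro comb_closed) auto
    then show ?thesis using a b by (simp add: M.a_comm)
  qed
  finally show ?case by (simp add: lessThan_Suc)
qed

text \<open>The coefficients are carried from indices to vectors by the inverse of \<open>b\<close>;
  a nonzero one would then witness linear dependence.\<close>

lemma (in module) zero_Rn_if_free:
  assumes b: "inj_on b {..<m}" "b \<in> {..<m} \<rightarrow> carrier M" "lin_indpt (b ` {..<m})"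
    and c: "c \<in> carrier (Rn R m)" "comb M c b m = \<zero>\<^bsub>M\<^esub>"
  shows "c = \<zero>\<^bsub>Rn R m\<^esub>"
proof -
  interpret P: module R "Rn R m" by (rule Rn_module)
  let ?a = "\<lambda>v. c (the_inv_into {..<m} b v)"
  have inv: "?a (b i) = c i" if "i < m" for i
    using that b(1) by (simp add: the_inv_into_f_f)
  have a: "?a \<in> b ` {..<m} \<rightarrow> carrier R"
    using c(1) Rn_coeff by (auto simp: inv simp del: the_inv_into_f_f)
  have lc: "lincomb ?a (b ` {..<m}) = \<zero>\<^bsub>M\<^esub>"
    unfolding lincomb_image_eq_comb[OF b(1,2) a] c(2)[symmetric]
    by (rule comb_cong) (simp_all add: inv)
  have "c i = \<zero>" if "i < m" for i
  proof (rule ccontr)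
    assume "c i \<noteq> \<zero>"
    then have "lin_dep (b ` {..<m})"
      using that by (intro lin_dep_crit[OF _ _ a _ _ lc, of _ "b i"]) (auto simp: inv)
    then show False using b(3) by contradiction
  qed
  then show ?thesis
    using c(1) by (intro Rn_ext[of c m]) (auto simp: Rn_apply)
qed

text \<open>Free modules are projective: a vector is replaced by its coordinates in a finite basis,
  and the basis vector \<open>b i\<close> is sent to a chosen preimage of \<open>g (b i)\<close>
  under \<open>p\<close>.\<close>

lemma free_lift:
  assumes free: "fin_gen_free_module R F"
    and g: "mod_hom R F M g" and p: "mod_hom R P M p" and sub: "g ` carrier F \<subseteq> p ` carrier P"
  obtains h where "mod_hom R F P h" "\<And>v. v \<in> carrier F \<Longrightarrow> p (h v) = g v"
proof -
  interpret F: module R F using g by (simp add: mod_hom_def)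
  interpret P: module R P using p by (simp add: mod_hom_def)
  interpret g: mod_hom R F M g by fact
  interpret p: mod_hom R P M p by fact
  from free obtain B where B: "finite B" "B \<subseteq> carrier F" "F.span B = carrier F" "F.lin_indpt B"
    unfolding fin_gen_free_module_def by blast
  obtain m :: nat and b where b: "B = b ` {..<m}" "inj_on b {..<m}"
    using finite_imp_nat_seg_image_inj_on[OF B(1)] by (auto simp: lessThan_def)
  have bF: "b \<in> {..<m} \<rightarrow> carrier F" using B b by auto
  interpret m: module R "Rn R m" by (rule F.Rn_module)
  interpret cb: mod_hom R "Rn R m" F "\<lambda>c. comb F c b m" by (rule F.comb_mod_hom[OF bF])
  \<comment> \<open>Coordinates are unique, since the difference of two coordinate vectors is a
    relation between basis vectors.\<close>
  have inj: "c = d" if "c \<in> carrier (Rn R m)" "d \<in> carrier (Rn R m)" "comb F c b m = comb F d b m" for c d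
  proof -
    have "comb F (c \<ominus>\<^bsub>Rn R m\<^esub> d) b m = \<zero>\<^bsub>F\<^esub>"
      using that by simp
    then have "c \<ominus>\<^bsub>Rn R m\<^esub> d = \<zero>\<^bsub>Rn R m\<^esub>"
      using that b B bF by (intro F.zero_Rn_if_free[of b]) auto
    then show ?thesis using that by simp
  qed
  have "carrier F = combs R F b m"
    using F.span_image_eq_combs[OF bF] B b by simp
  then have "\<forall>v\<in>carrier F. \<exists>c\<in>carrier (Rn R m). comb F c b m = v"
    by (auto simp: combs_def)
  then obtain k where k: "\<And>v. v \<in> carrier F \<Longrightarrow> k v \<in> carrier (Rn R m) \<and> comb F (k v) b m = v"
    by metis
  \<comment> \<open>Linearity of \<open>k\<close> follows from uniqueness: both sides are
    coordinates of the same vector.\<close>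
  have k_hom: "mod_hom R F (Rn R m) k"
  proof (rule mod_homI)
    fix u v assume uv: "u \<in> carrier F" "v \<in> carrier F"
    show "k (u \<oplus>\<^bsub>F\<^esub> v) = k u \<oplus>\<^bsub>Rn R m\<^esub> k v"
      by (rule inj) (use uv k in auto)
  next
    fix r v assume rv: "r \<in> carrier R" "v \<in> carrier F"
    show "k (r \<odot>\<^bsub>F\<^esub> v) = r \<odot>\<^bsub>Rn R m\<^esub> k v"
      by (rule inj) (use rv k in auto)
  qed (use k in \<open>auto simp: F.module_axioms m.module_axioms\<close>)
  have "\<forall>i\<in>{..<m}. \<exists>q\<in>carrier P. p q = g (b i)"
    using sub bF by (metis (no_types, lifting) Pi_mem image_iff subsetD)
  then obtain q where q: "\<And>i. i < m \<Longrightarrow> q i \<in> carrier P \<and> p (q i) = g (b i)"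
    by (metis lessThan_iff)
  then have qP: "q \<in> {..<m} \<rightarrow> carrier P" by auto
  show thesis
  proof
    show "mod_hom R F P (\<lambda>v. comb P (k v) q m)"
      by (rule mod_hom_compose[OF k_hom P.comb_mod_hom[OF qP]])
    fix v assume v: "v \<in> carrier F"
    have kv: "k v \<in> {..<m} \<rightarrow> carrier R" using k[OF v] by (auto intro: F.Rn_coeff)
    have "p (comb P (k v) q m) = comb M (k v) (\<lambda>i. g (b i)) m"
      using p.hom_comb[OF kv qP] q by (auto intro: comb_cong)
    also have "\<dots> = g v"
      using g.hom_comb[OF kv bF] k[OF v] by simp
    finally show "p (comb P (k v) q m) = g v" .
  qed
qed

text \<open>Schanuel's lemma: \<open>a = (a - \<theta> (\<eta> a)) + \<theta> (\<eta> a)\<close> for lifts \<open>\<eta>\<close>, \<open>\<theta>\<close> of the identity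
  of \<open>M\<close> between \<open>R\<^sup>n\<close> and the given free module.\<close>
lemma (in module) syz_S_fin_if_S_finitely_presented:
  assumes x: "x \<in> {..<n} \<rightarrow> carrier M" "carrier M = combs R M x n"
    and S: "S \<subseteq> carrier R" and pres: "S_finitely_presented R S M"
  shows "S_finite_in R S (Rn R n) (syz R M x n)"
proof -
  from pres obtain K F :: "('a, nat \<Rightarrow> 'a) module" and f g where
    ex: "short_exact R K F M f g" and K: "S_finite R S K" and F: "fin_gen_free_module R F"
    unfolding S_finitely_presented_def by blast
  interpret f: mod_hom R K F f using ex by (simp add: short_exact_def)
  interpret g: mod_hom R F M g using ex by (simp add: short_exact_def)
  interpret P: module R "Rn R n" by (rule Rn_module)
  interpret p: mod_hom R "Rn R n" M "\<lambda>c. comb M c x n" by (rule comb_mod_hom[OF x(1)])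
  have imf: "f ` carrier K = {v \<in> carrier F. g v = \<zero>\<^bsub>M\<^esub>}" and img: "g ` carrier F = carrier M"
    using ex by (auto simp: short_exact_def f.im_def g.ker_def g.im_def)
  obtain s w l where s: "s \<in> S" and w: "w \<in> {..<l} \<rightarrow> carrier K"
    and sw: "\<And>v. v \<in> carrier K \<Longrightarrow> s \<odot>\<^bsub>K\<^esub> v \<in> combs R K w l"
    using K unfolding f.M.S_finite_iff S_finite_in_def by blast
  have sR: "s \<in> carrier R" using s S by auto
  \<comment> \<open>The lift \<theta>, from \<open>F\<close> to \<open>Rn R n\<close>.\<close>
  obtain t where t: "mod_hom R F (Rn R n) t" "\<And>v. v \<in> carrier F \<Longrightarrow> comb M (t v) x n = g v"
    using free_lift[OF F g.mod_hom_axioms p.mod_hom_axioms] img x(2) unfolding combs_def by blast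
  interpret t: mod_hom R F "Rn R n" t by fact
  have "\<forall>i\<in>{..<n}. \<exists>u\<in>carrier F. g u = x i"
    using img x(1) by (metis (no_types, lifting) Pi_mem image_iff)
  \<comment> \<open>Preimages of the generators under \<open>g\<close>; combining them gives the
    lift \<eta>, from \<open>Rn R n\<close> to \<open>F\<close>.\<close>
  then obtain u where u: "\<And>i. i < n \<Longrightarrow> u i \<in> carrier F \<and> g (u i) = x i"
    by (metis lessThan_iff)
  then have uF: "u \<in> {..<n} \<rightarrow> carrier F" by auto
  interpret h: mod_hom R "Rn R n" F "\<lambda>c. comb F c u n"
    by (rule f.N.comb_mod_hom[OF uF])
  have gh: "g (comb F c u n) = comb M c x n" if "c \<in> carrier (Rn R n)" for c
  proof -
    have "g (comb F c u n) = comb M c (\<lambda>i. g (u i)) n"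
      using g.hom_comb[of c n u] that uF by (auto simp: Rn_carrier)
    also have "\<dots> = comb M c x n"
      by (rule comb_cong) (use u in auto)
    finally show ?thesis .
  qed
  \<comment> \<open>The first summand a - \<theta> (\<eta> a) as a linear map. Its values are
    syzygies of \<open>x\<close> even when \<open>c\<close> is not one, because both lifts respect
    the maps to \<open>M\<close>; so its image is generated by the syzygies
    \<open>D (unit n i)\<close>.\<close>
  define D where "D = (\<lambda>c. c \<ominus>\<^bsub>Rn R n\<^esub> t (comb F c u n))"
  interpret th: mod_hom R "Rn R n" "Rn R n" "\<lambda>c. t (comb F c u n)"
    by (rule mod_hom_compose[OF h.mod_hom_axioms t.mod_hom_axioms])
  interpret D: mod_hom R "Rn R n" "Rn R n" D
    unfolding D_def by (rule mod_hom_diff[OF _ th.mod_hom_axioms], rule mod_homI) (simp_all add: P.module_axioms)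
  have D_syz: "D c \<in> syz R M x n" if "c \<in> carrier (Rn R n)" for c
    using that unfolding syz_def D_def by (simp add: t(2) gh)
  \<comment> \<open>Generators for both summands: the \<open>n\<close> values of \<open>D\<close> on
    unit vectors, then the images in \<open>Rn R n\<close> of the family \<open>w\<close>, whose
    span contains all \<open>s\<close>-multiples of elements of \<open>K\<close>.\<close>
  let ?z = "\<lambda>i. if i < n then D (unit n i) else t (f (w (i - n)))"
  have "?z \<in> {..<n + l} \<rightarrow> syz R M x n"
  proof
    fix i assume i: "i \<in> {..<n + l}"
    have "t (f v) \<in> syz R M x n" if "v \<in> carrier K" for v
      using that imf by (auto simp: syz_def t(2))
    moreover have "w (i - n) \<in> carrier K" if "\<not> i < n"
      using that i by (intro Pi_mem[OF w]) auto
    ultimately show "?z i \<in> syz R M x n"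
      using D_syz unit_in_Rn by auto
  qed
  moreover have "s \<odot>\<^bsub>Rn R n\<^esub> a \<in> combs R (Rn R n) ?z (n + l)" if a: "a \<in> syz R M x n" for a
  proof -
    have aP: "a \<in> carrier (Rn R n)" "comb M a x n = \<zero>\<^bsub>M\<^esub>" using a by (auto simp: syz_def)
    \<comment> \<open>For a syzygy \<open>a\<close>, the element \<eta> a lies in the kernel of
      \<open>g\<close> and hence comes from \<open>K\<close>, where multiplication by
      \<open>s\<close> lands in the span of \<open>w\<close>.\<close>
    have "comb F a u n \<in> f ` carrier K"
      unfolding imf using aP gh by simp
    then obtain v where v: "v \<in> carrier K" "comb F a u n = f v" by blast
    obtain c where c: "c \<in> carrier (Rn R l)" "s \<odot>\<^bsub>K\<^esub> v = comb K c w l"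
      using sw[OF v(1)] unfolding combs_def by blast
    have c': "c \<in> {..<l} \<rightarrow> carrier R" using c by (auto intro: Rn_coeff)
    have fw: "(\<lambda>i. f (w i)) \<in> {..<l} \<rightarrow> carrier F" using w by auto
    have 1: "s \<odot>\<^bsub>Rn R n\<^esub> t (comb F a u n) = comb (Rn R n) c (\<lambda>i. t (f (w i))) l"
    proof -
      have "s \<odot>\<^bsub>Rn R n\<^esub> t (comb F a u n) = t (f (s \<odot>\<^bsub>K\<^esub> v))"
        using v sR by simp
      also have "\<dots> = t (comb F c (\<lambda>i. f (w i)) l)"
        using c f.hom_comb[OF c' w] by simp
      also have "\<dots> = comb (Rn R n) c (\<lambda>i. t (f (w i))) l"
        using t.hom_comb[OF c' fw] by simp
      finally show ?thesis .
    qed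
    let ?sa = "s \<odot>\<^bsub>Rn R n\<^esub> a"
    have sa: "?sa \<in> carrier (Rn R n)" using aP sR by simp
    have sa': "?sa \<in> {..<n} \<rightarrow> carrier R" using sa by (auto intro: Rn_coeff)
    have un: "unit n \<in> {..<n} \<rightarrow> carrier (Rn R n)" by (auto intro: unit_in_Rn)
    have 2: "D ?sa = comb (Rn R n) ?sa (\<lambda>i. D (unit n i)) n"
      using D.hom_comb[OF sa' un] comb_Rn_unit[OF sa] by simp
    have "?sa = D ?sa \<oplus>\<^bsub>Rn R n\<^esub> s \<odot>\<^bsub>Rn R n\<^esub> t (comb F a u n)"
      using aP sR unfolding D_def th.f_smult[OF sR aP(1)]
      by (simp add: a_minus_def P.M.a_assoc P.M.l_neg del: t.f_smult h.f_smult)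
    also have "\<dots> = comb (Rn R n) (\<lambda>i. if i < n then ?sa i else c (i - n)) ?z (n + l)"
      unfolding 1 2
      by (rule P.comb_append[symmetric, OF sa' _ c']) (use w unit_in_Rn in auto)
    also have "\<dots> \<in> combs R (Rn R n) ?z (n + l)"
      by (rule P.comb_in_combs) (use Rn_coeff[OF sa] Rn_coeff[OF c(1)] in auto)
    finally show ?thesis .
  qed
  ultimately show ?thesis
    unfolding S_finite_in_def using s by blast
qed

section \<open>From syzygies back to presentations, and the criterion for coherence\<close>

lemma (in cring) Rn_free: "fin_gen_free_module R (Rn R n)"
proof -
  interpret P: module R "Rn R n" by (rule Rn_module)
  let ?B = "unit n ` {..<n}"
  have un: "unit n \<in> {..<n} \<rightarrow> carrier (Rn R n)" by (auto intro: unit_in_Rn)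
  have "P.span ?B = carrier (Rn R n)"
    unfolding P.span_image_eq_combs[OF un] combs_def using comb_Rn_unit by force
  moreover have "P.lin_indpt ?B"
  proof (rule P.finite_lin_indpt2)
    show "finite ?B" "?B \<subseteq> carrier (Rn R n)" using un by auto
    fix a assume a: "a \<in> ?B \<rightarrow> carrier R" "P.lincomb a ?B = \<zero>\<^bsub>Rn R n\<^esub>"
    show "\<forall>v\<in>?B. a v = \<zero>"
    \<comment> \<open>In the zero ring the unit vectors coincide and \<open>unit n\<close> may fail
      to be injective, but every coefficient is zero.\<close>
    proof (cases "\<one> = \<zero>")
      case True
      then have "carrier R = {\<zero>}" using carrier_one_zero by simp
      then show ?thesis using a by auto
    next
      case False
      have inj: "inj_on (unit n) {..<n}"
        using False by (auto simp: inj_on_def unit_def restrict_def fun_eq_iff)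
      let ?c = "\<lambda>i\<in>{..<n}. a (unit n i)"
      have c: "?c \<in> carrier (Rn R n)"
        by (rule restrict_in_Rn) (use a in auto)
      have "?c = comb (Rn R n) ?c (unit n) n"
        by (rule comb_Rn_unit[OF c, symmetric])
      also have "\<dots> = comb (Rn R n) (\<lambda>i. a (unit n i)) (unit n) n"
        by (rule comb_cong) auto
      also have "\<dots> = \<zero>\<^bsub>Rn R n\<^esub>"
        using P.lincomb_image_eq_comb[OF inj un a(1)] a(2) by simp
      finally have "?c = \<zero>\<^bsub>Rn R n\<^esub>" .
      then have "?c i = \<zero>" if "i < n" for i
        using Rn_apply(3)[OF that] by simp
      then show ?thesis by auto
    qed
  qed
  ultimately show ?thesis
    unfolding fin_gen_free_module_def using un Rn_module by blast
qed

text \<open>The presentation is the canonical one: the syzygies are included in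
  \<open>Rn R n\<close>, which is mapped onto \<open>M\<close> by \<open>x\<close>. Both modules
  have the element type that the definition prescribes.\<close>

lemma (in module) S_finitely_presented_if_syz_S_fin:
  assumes x: "x \<in> {..<n} \<rightarrow> carrier M" "carrier M = combs R M x n"
    and syz: "S_finite_in R S (Rn R n) (syz R M x n)"
  shows "S_finitely_presented R S M"
proof -
  interpret P: module R "Rn R n" by (rule Rn_module)
  interpret p: mod_hom R "Rn R n" M "\<lambda>c. comb M c x n" by (rule comb_mod_hom[OF x(1)])
  let ?K = "(Rn R n)\<lparr>carrier := syz R M x n\<rparr>"
  have K: "module R ?K"
    by (rule P.submodule_is_module[OF syz_submodule[OF x(1)]])
  have i: "mod_hom R ?K (Rn R n) (\<lambda>c. c)"
    by (rule mod_homI[OF K]) (auto simp: P.module_axioms syz_def)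
  have "short_exact R ?K (Rn R n) M (\<lambda>c. c) (\<lambda>c. comb M c x n)"
    unfolding short_exact_def mod_hom.im_def[OF i] p.ker_def p.im_def
    using x(2) i by (auto simp: p.mod_hom_axioms syz_def combs_def)
  moreover have "S_finite R S ?K"
    using syz unfolding module.S_finite_iff[OF K] by (simp add: S_finite_in_def)
  ultimately show ?thesis
    unfolding S_finitely_presented_def using Rn_free by blast
qed

text \<open>The finitely generated submodules are the spans of finite families, and a family has the
  same syzygies in its span as in \<open>M\<close>. Schanuel's lemma passes from an arbitrary
  presentation of the span to these syzygies; conversely the syzygies give a presentation.\<close>

lemma (in module) S_coherent_module_iff:
  assumes "S \<subseteq> carrier R"
  shows "S_coherent_module R S M \<longleftrightarrow> fin_gen_module R M \<and> syz_S_fin R S M"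
proof (intro iffI conjI)
  assume coh: "S_coherent_module R S M"
  then show "fin_gen_module R M" by (simp add: S_coherent_module_def)
  show "syz_S_fin R S M"
    unfolding syz_S_fin_def
  proof (intro allI impI)
    fix n and x :: "nat \<Rightarrow> _" assume x: "x \<in> {..<n} \<rightarrow> carrier M"
    let ?N = "combs R M x n"
    have sub: "submodule R ?N M" by (rule combs_submodule[OF x])
    have xN: "x \<in> {..<n} \<rightarrow> ?N" using in_combs[OF _ x] by auto
    then have "fin_gen_module R (M\<lparr>carrier := ?N\<rparr>)"
      unfolding fin_gen_submodule_iff[OF sub] by blast
    then have "S_finitely_presented R S (M\<lparr>carrier := ?N\<rparr>)"
      using coh sub unfolding S_coherent_module_def by blast
    then show "S_finite_in R S (Rn R n) (syz R M x n)"
      using module.syz_S_fin_if_S_finitely_presented[OF submodule_is_module[OF sub], of x n] xN assms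
      by simp
  qed
next
  assume asm: "fin_gen_module R M \<and> syz_S_fin R S M"
  have "S_finitely_presented R S (M\<lparr>carrier := N\<rparr>)"
    if N: "submodule R N M" "fin_gen_module R (M\<lparr>carrier := N\<rparr>)" for N
  proof -
    obtain x n where x: "x \<in> {..<n} \<rightarrow> N" "N = combs R M x n"
      using N fin_gen_submodule_iff by blast
    have "N \<subseteq> carrier M" using N(1) by (simp add: submodule_def)
    then have "S_finite_in R S (Rn R n) (syz R M x n)"
      using asm x(1) unfolding syz_S_fin_def by blast
    then show ?thesis
      using module.S_finitely_presented_if_syz_S_fin[OF submodule_is_module[OF N(1)], of x n S] x
      by simp
  qed
  then show "S_coherent_module R S M"
    using asm by (simp add: S_coherent_module_def)
qed

section \<open>Finite presentation as the case \<open>S = {1}\<close>\<close>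

lemma (in module) fin_gen_module_iff_S_finite_one:
  "fin_gen_module R M \<longleftrightarrow> S_finite R {\<one>} M"
proof
  assume "fin_gen_module R M"
  then show "S_finite R {\<one>} M"
    unfolding fin_gen_module_iff S_finite_iff S_finite_in_def by auto
next
  assume "S_finite R {\<one>} M"
  then obtain w l where w: "w \<in> {..<l} \<rightarrow> carrier M" "\<forall>v\<in>carrier M. \<one> \<odot>\<^bsub>M\<^esub> v \<in> combs R M w l"
    unfolding S_finite_iff S_finite_in_def by blast
  moreover have "combs R M w l \<subseteq> carrier M"
    using combs_submodule[OF w(1)] by (simp add: submodule_def)
  ultimately show "fin_gen_module R M"
    unfolding fin_gen_module_iff by (intro exI[of _ w] exI[of _ l]) auto
qed

text \<open>With multiplier one, \<open>S\<close>-finite means finitely generated. This makes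
  Schanuel's lemma available for ordinary finite presentations.\<close>

lemma finitely_presented_iff_S_finitely_presented_one:
  "finitely_presented R M \<longleftrightarrow> S_finitely_presented R {\<one>\<^bsub>R\<^esub>} M"
proof -
  have "fin_gen_module R K \<longleftrightarrow> S_finite R {\<one>\<^bsub>R\<^esub>} K"
    if "short_exact R K F M f g" for K F :: "('a, nat \<Rightarrow> 'a) module" and f g
    using that module.fin_gen_module_iff_S_finite_one
    by (auto simp: short_exact_def mod_hom_def)
  then show ?thesis
    unfolding finitely_presented_def S_finitely_presented_def by blast
qed

subsection \<open>Modules with \<open>S\<close>-finite syzygies\<close>

lemma (in module) smult_comb:
  assumes "r \<in> carrier R" "c \<in> carrier (Rn R n)" "x \<in> {..<n} \<rightarrow> carrier M"
  shows "r \<odot>\<^bsub>M\<^esub> comb M c x n = comb M (r \<odot>\<^bsub>Rn R n\<^esub> c) x n"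
  using module_hom_smult[OF mod_hom.f_hom[OF comb_mod_hom[OF assms(3)]] assms(1,2)] by simp

text \<open>Substitution, from linearity of \<open>comb\<close> in its coefficients: a combination
  of coefficient vectors \<open>w k\<close>, evaluated on \<open>x\<close>, is the same combination
  of their values on \<open>x\<close>.\<close>

lemma (in module) comb_comb:
  assumes "c \<in> {..<l} \<rightarrow> carrier R" "w \<in> {..<l} \<rightarrow> carrier (Rn R n)" "x \<in> {..<n} \<rightarrow> carrier M"
  shows "comb M (comb (Rn R n) c w l) x n = comb M c (\<lambda>k. comb M (w k) x n) l"
  using mod_hom.hom_comb[OF comb_mod_hom[OF assms(3)] assms(1,2)] by simp

text \<open>Jointly, \<open>p\<close> and \<open>q\<close> embed \<open>A\<close> in the direct sum
  of \<open>M\<close> and \<open>N\<close>. Syzygies are treated in two stages: first those of the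
  images under \<open>q\<close>, giving relations \<open>w\<close> and a multiplier
  \<open>s\<close>, then those of the images under \<open>p\<close> of the values \<open>y\<close>
  of these relations, giving a multiplier \<open>t\<close>. Substitution yields generators with
  multiplier \<open>t\<close> times \<open>s\<close>.\<close>

lemma syz_S_fin_jointly_injective:
  assumes S: "S \<subseteq> carrier R" "\<And>s t. s \<in> S \<Longrightarrow> t \<in> S \<Longrightarrow> s \<otimes>\<^bsub>R\<^esub> t \<in> S"
    and p: "mod_hom R A M p" and q: "mod_hom R A N q"
    and inj: "\<And>v. v \<in> carrier A \<Longrightarrow> p v = \<zero>\<^bsub>M\<^esub> \<Longrightarrow> q v = \<zero>\<^bsub>N\<^esub> \<Longrightarrow> v = \<zero>\<^bsub>A\<^esub>"
    and M: "syz_S_fin R S M" and N: "syz_S_fin R S N"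
  shows "syz_S_fin R S A"
  unfolding syz_S_fin_def
proof (intro allI impI)
  fix n and x :: "nat \<Rightarrow> _" assume x: "x \<in> {..<n} \<rightarrow> carrier A"
  interpret A: module R A using p by (simp add: mod_hom_def)
  interpret M: module R M using p by (simp add: mod_hom_def)
  interpret N: module R N using q by (simp add: mod_hom_def)
  interpret p: mod_hom R A M p by fact
  interpret q: mod_hom R A N q by fact
  interpret P: module R "Rn R n" by (rule A.Rn_module)
  have "(\<lambda>i. q (x i)) \<in> {..<n} \<rightarrow> carrier N" using x by auto
  then obtain s w l where s: "s \<in> S" and w: "w \<in> {..<l} \<rightarrow> syz R N (\<lambda>i. q (x i)) n"
    and sw: "\<And>a. a \<in> syz R N (\<lambda>i. q (x i)) n \<Longrightarrow> s \<odot>\<^bsub>Rn R n\<^esub> a \<in> combs R (Rn R n) w l"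
    using N unfolding syz_S_fin_def S_finite_in_def by meson
  interpret L: module R "Rn R l" by (rule A.Rn_module)
  have wP: "w \<in> {..<l} \<rightarrow> carrier (Rn R n)" using w by (auto simp: syz_def)
  \<comment> \<open>These elements are killed by \<open>q\<close>, so a combination of them vanishes
    as soon as its image under \<open>p\<close> does.\<close>
  define y where "y = (\<lambda>k. comb A (w k) x n)"
  have yA: "y \<in> {..<l} \<rightarrow> carrier A"
    using wP x by (auto simp: y_def A.Rn_carrier Pi_iff PiE_iff intro!: A.comb_closed)
  have qy: "q (y k) = \<zero>\<^bsub>N\<^esub>" if "k < l" for k
  proof -
    have wk: "w k \<in> syz R N (\<lambda>i. q (x i)) n" using w that by auto
    then have "w k \<in> {..<n} \<rightarrow> carrier R" by (auto simp: syz_def intro: A.Rn_coeff)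
    then show ?thesis using q.hom_comb[OF _ x] wk unfolding y_def syz_def by simp
  qed
  have "(\<lambda>i. p (y i)) \<in> {..<l} \<rightarrow> carrier M" using yA by auto
  then obtain t v h where t: "t \<in> S" and v: "v \<in> {..<h} \<rightarrow> syz R M (\<lambda>i. p (y i)) l"
    and tv: "\<And>b. b \<in> syz R M (\<lambda>i. p (y i)) l \<Longrightarrow> t \<odot>\<^bsub>Rn R l\<^esub> b \<in> combs R (Rn R l) v h"
    using M unfolding syz_S_fin_def S_finite_in_def by meson
  have vL: "v \<in> {..<h} \<rightarrow> carrier (Rn R l)" using v by (auto simp: syz_def)
  \<comment> \<open>A syzygy \<open>v k\<close> of the images of \<open>y\<close>, rewritten in
    terms of \<open>x\<close>, is a syzygy of \<open>x\<close> in \<open>A\<close>; these are the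
    final generators.\<close>
  define u where "u = (\<lambda>k. comb (Rn R n) (v k) w l)"
  have "u k \<in> syz R A x n" if k: "k < h" for k
  proof -
    have vk: "v k \<in> syz R M (\<lambda>i. p (y i)) l" using v k by auto
    then have vk': "v k \<in> {..<l} \<rightarrow> carrier R" by (auto simp: syz_def intro: A.Rn_coeff)
    have uP: "u k \<in> carrier (Rn R n)"
      unfolding u_def by (rule P.comb_closed[OF vk' wP])
    have eq: "comb A (u k) x n = comb A (v k) y l"
      unfolding u_def y_def by (rule A.comb_comb[OF vk' wP x])
    have "comb A (v k) y l = \<zero>\<^bsub>A\<^esub>"
    proof (rule inj)
      show "comb A (v k) y l \<in> carrier A" by (rule A.comb_closed[OF vk' yA])
      show "p (comb A (v k) y l) = \<zero>\<^bsub>M\<^esub>"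
        using p.hom_comb[OF vk' yA] vk by (simp add: syz_def)
      show "q (comb A (v k) y l) = \<zero>\<^bsub>N\<^esub>"
        using q.hom_comb[OF vk' yA] N.comb_eq_zero[of l "v k" "\<lambda>i. q (y i)"] qy vk'
        by (simp add: Pi_iff)
    qed
    then show ?thesis using uP eq by (simp add: syz_def)
  qed
  then have "u \<in> {..<h} \<rightarrow> syz R A x n" by auto
  moreover have "(t \<otimes>\<^bsub>R\<^esub> s) \<odot>\<^bsub>Rn R n\<^esub> a \<in> combs R (Rn R n) u h" if a: "a \<in> syz R A x n" for a
  proof -
    have aP: "a \<in> carrier (Rn R n)" and a0: "comb A a x n = \<zero>\<^bsub>A\<^esub>" using a by (auto simp: syz_def)
    have a': "a \<in> {..<n} \<rightarrow> carrier R" using aP by (auto intro: A.Rn_coeff)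
    have "a \<in> syz R N (\<lambda>i. q (x i)) n"
      using q.hom_comb[OF a' x] aP a0 by (simp add: syz_def)
    then obtain b where b: "b \<in> carrier (Rn R l)" "s \<odot>\<^bsub>Rn R n\<^esub> a = comb (Rn R n) b w l"
      using sw unfolding combs_def by blast
    have b': "b \<in> {..<l} \<rightarrow> carrier R" using b by (auto intro: A.Rn_coeff)
    have sR: "s \<in> carrier R" and tR: "t \<in> carrier R" using s t S by auto
    \<comment> \<open>The coefficients \<open>b\<close> express the \<open>s\<close>-multiple of
      \<open>a\<close> through \<open>w\<close>. As \<open>a\<close> is a relation on
      \<open>x\<close>, \<open>b\<close> is one on \<open>y\<close>, and the second stage applies to
      it.\<close>
    have "comb A b y l = comb A (s \<odot>\<^bsub>Rn R n\<^esub> a) x n"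
      unfolding b(2) y_def by (rule A.comb_comb[OF b' wP x, symmetric])
    also have "\<dots> = \<zero>\<^bsub>A\<^esub>"
      using A.smult_comb[OF sR aP x] a0 sR by simp
    finally have "b \<in> syz R M (\<lambda>i. p (y i)) l"
      using p.hom_comb[OF b' yA] b(1) by (simp add: syz_def)
    then obtain c where c: "c \<in> carrier (Rn R h)" "t \<odot>\<^bsub>Rn R l\<^esub> b = comb (Rn R l) c v h"
      using tv unfolding combs_def by blast
    have c': "c \<in> {..<h} \<rightarrow> carrier R" using c by (auto intro: A.Rn_coeff)
    have "(t \<otimes>\<^bsub>R\<^esub> s) \<odot>\<^bsub>Rn R n\<^esub> a = t \<odot>\<^bsub>Rn R n\<^esub> comb (Rn R n) b w l"
      using sR tR aP b(2) by (simp add: P.smult_assoc1)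
    also have "\<dots> = comb (Rn R n) (comb (Rn R l) c v h) w l"
      unfolding c(2)[symmetric] by (rule P.smult_comb[OF tR b(1) wP])
    also have "\<dots> = comb (Rn R n) c u h"
      unfolding u_def by (rule P.comb_comb[OF c' vL wP])
    also have "\<dots> \<in> combs R (Rn R n) u h"
      by (rule P.comb_in_combs[OF c'])
    finally show ?thesis .
  qed
  ultimately show "S_finite_in R S (Rn R n) (syz R A x n)"
    unfolding S_finite_in_def using S(2)[OF t s] by blast
qed

text \<open>Induction on \<open>n\<close>: a vector of length \<open>n + 1\<close> is determined by
  its first \<open>n\<close> coordinates and its last one, the two maps to which
  \<open>syz_S_fin_jointly_injective\<close> is applied.\<close>

lemma (in cring) syz_S_fin_Rn:
  assumes S: "S \<subseteq> carrier R" "\<And>s t. s \<in> S \<Longrightarrow> t \<in> S \<Longrightarrow> s \<otimes> t \<in> S"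
    and coh: "syz_S_fin R S (self_module R)"
  shows "syz_S_fin R S (Rn R n)"
proof (induction n)
  case 0
  \<comment> \<open>An element of \<open>S\<close> comes from the hypothesis on \<open>R\<close>,
    applied to the empty family.\<close>
  obtain s where s: "s \<in> S"
    using coh unfolding syz_S_fin_def S_finite_in_def by (meson Pi_I' lessThan_iff not_less_zero)
  have "S_finite_in R S (Rn R m) (syz R (Rn R 0) x m)" if x: "x \<in> {..<m} \<rightarrow> carrier (Rn R 0)"
    for m and x :: "nat \<Rightarrow> _"
  proof -
    interpret O: module R "Rn R 0" by (rule Rn_module)
    interpret P: module R "Rn R m" by (rule Rn_module)
    have zero: "v = \<zero>\<^bsub>Rn R 0\<^esub>" if "v \<in> carrier (Rn R 0)" for v
      using that O.zero_closed by (rule Rn_ext) simp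
    have "comb (Rn R 0) c x m = \<zero>\<^bsub>Rn R 0\<^esub>" if "c \<in> carrier (Rn R m)" for c
      by (rule zero, rule O.comb_closed[OF _ x]) (use Rn_coeff[OF that] in auto)
    \<comment> \<open>All combinations in \<open>Rn R 0\<close> are zero, so every coefficient
      vector is a syzygy and the unit vectors generate.\<close>
    then have syz: "syz R (Rn R 0) x m = carrier (Rn R m)"
      unfolding syz_def by blast
    have "s \<odot>\<^bsub>Rn R m\<^esub> v \<in> combs R (Rn R m) (unit m) m" if v: "v \<in> carrier (Rn R m)" for v
    proof -
      have "s \<odot>\<^bsub>Rn R m\<^esub> v \<in> carrier (Rn R m)" using v s S by auto
      then show ?thesis unfolding combs_def using comb_Rn_unit by force
    qed
    then show ?thesis
      unfolding S_finite_in_def syz using s unit_in_Rn by blast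
  qed
  then show ?case unfolding syz_S_fin_def by blast
next
  case (Suc n)
  show ?case
  proof (rule syz_S_fin_jointly_injective[OF S Rn_restrict_hom[of n "Suc n"] Rn_eval_hom[of n "Suc n"]])
    fix v assume v: "v \<in> carrier (Rn R (Suc n))" "restrict v {..<n} = \<zero>\<^bsub>Rn R n\<^esub>" "v n = \<zero>\<^bsub>self_module R\<^esub>"
    interpret P: module R "Rn R (Suc n)" by (rule Rn_module)
    show "v = \<zero>\<^bsub>Rn R (Suc n)\<^esub>"
    proof (rule Rn_ext)
      fix i assume i: "i < Suc n"
      have "v i = \<zero>"
      proof (cases "i = n")
        case True
        then show ?thesis using v(3) by (simp add: self_module_def)
      next
        case False
        then have "i < n" using i by simp
        then show ?thesis using fun_cong[OF v(2), of i] Rn_apply(3)[of i n] by simp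
      qed
      then show "v i = \<zero>\<^bsub>Rn R (Suc n)\<^esub> i" using i by (simp add: Rn_apply)
    qed (use v in auto)
  qed (use Suc coh in auto)
qed

text \<open>With lifts \<open>c\<close> of \<open>z\<close>, a vector \<open>a\<close> is a syzygy
  of \<open>z\<close> iff its combination of \<open>c\<close> lies in the kernel, the span of
  \<open>w\<close>; that is, iff \<open>a\<close> extends to a syzygy of \<open>c\<close> followed
  by \<open>w\<close>. Cutting off the last \<open>l\<close> coordinates is linear and carries
  generators over with the same multiplier.\<close>

lemma syz_S_fin_quotient:
  assumes S: "S \<subseteq> carrier R" and p: "mod_hom R F M p" and surj: "p ` carrier F = carrier M"
    and w: "w \<in> {..<l} \<rightarrow> carrier F" "{v \<in> carrier F. p v = \<zero>\<^bsub>M\<^esub>} = combs R F w l"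
    and F: "syz_S_fin R S F"
  shows "syz_S_fin R S M"
  unfolding syz_S_fin_def
proof (intro allI impI)
  fix n and z :: "nat \<Rightarrow> _" assume z: "z \<in> {..<n} \<rightarrow> carrier M"
  interpret F: module R F using p by (simp add: mod_hom_def)
  interpret M: module R M using p by (simp add: mod_hom_def)
  interpret p: mod_hom R F M p by fact
  interpret P: module R "Rn R n" by (rule F.Rn_module)
  interpret L: module R "Rn R l" by (rule F.Rn_module)
  interpret Q: module R "Rn R (n + l)" by (rule F.Rn_module)
  interpret r: mod_hom R "Rn R (n + l)" "Rn R n" "\<lambda>c. restrict c {..<n}"
    by (rule F.Rn_restrict_hom) simp
  have "\<forall>i\<in>{..<n}. \<exists>c\<in>carrier F. p c = z i"
    using surj z by (metis (no_types, lifting) Pi_mem image_iff)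
  then obtain c where c: "\<And>i. i < n \<Longrightarrow> c i \<in> carrier F \<and> p (c i) = z i"
    by (metis lessThan_iff)
  then have cF: "c \<in> {..<n} \<rightarrow> carrier F" by auto
  have pc: "p (comb F a c n) = comb M a z n" if "a \<in> {..<n} \<rightarrow> carrier R" for a
  proof -
    have "p (comb F a c n) = comb M a (\<lambda>i. p (c i)) n"
      using p.hom_comb[OF that cF] by simp
    also have "\<dots> = comb M a z n"
      by (rule comb_cong) (use c in auto)
    finally show ?thesis .
  qed
  define e where "e = (\<lambda>i. if i < n then c i else w (i - n))"
  have eF: "e \<in> {..<n + l} \<rightarrow> carrier F"
  proof
    fix i assume "i \<in> {..<n + l}"
    then show "e i \<in> carrier F"
      unfolding e_def using c Pi_mem[OF w(1), of "i - n"] by auto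
  qed
  obtain s v h where s: "s \<in> S" and v: "v \<in> {..<h} \<rightarrow> syz R F e (n + l)"
    and sv: "\<And>d. d \<in> syz R F e (n + l) \<Longrightarrow> s \<odot>\<^bsub>Rn R (n + l)\<^esub> d \<in> combs R (Rn R (n + l)) v h"
    using F eF unfolding syz_S_fin_def S_finite_in_def by meson
  have sR: "s \<in> carrier R" using s S by auto
  have vQ: "v \<in> {..<h} \<rightarrow> carrier (Rn R (n + l))" using v by (auto simp: syz_def)
  \<comment> \<open>The truncation of a syzygy of \<open>e\<close> is a syzygy of \<open>z\<close>,
    because \<open>p\<close> kills the part belonging to \<open>w\<close>.\<close>
  have "restrict (v k) {..<n} \<in> syz R M z n" if k: "k < h" for k
  proof -
    have vk: "v k \<in> carrier (Rn R (n + l))" "comb F (v k) e (n + l) = \<zero>\<^bsub>F\<^esub>"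
      using v k by (auto simp: syz_def)
    have co: "v k i \<in> carrier R" if "i < n + l" for i using vk(1) that by (rule F.Rn_coeff)
    let ?b = "\<lambda>i. v k (i + n)"
    have b: "?b \<in> {..<l} \<rightarrow> carrier R" using co by auto
    have a: "v k \<in> {..<n} \<rightarrow> carrier R" using co by auto
    have "comb F (v k) e (n + l) = comb F (\<lambda>i. if i < n then v k i else ?b (i - n)) e (n + l)"
      by (rule comb_cong) auto
    also have "\<dots> = comb F (v k) c n \<oplus>\<^bsub>F\<^esub> comb F ?b w l"
      unfolding e_def by (rule F.comb_append[OF a cF b w(1)])
    finally have "p (comb F (v k) c n) \<oplus>\<^bsub>M\<^esub> p (comb F ?b w l) = \<zero>\<^bsub>M\<^esub>"
      using vk(2) F.comb_closed[OF a cF] F.comb_closed[OF b w(1)] p.f_add p.f0_is_0 by metis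
    moreover have "p (comb F ?b w l) = \<zero>\<^bsub>M\<^esub>"
      using F.comb_in_combs[OF b, of w] w(2) by auto
    ultimately have "comb M (v k) z n = \<zero>\<^bsub>M\<^esub>"
      using pc[OF a] p.f_im[OF F.comb_closed[OF a cF]] by simp
    moreover have "comb M (restrict (v k) {..<n}) z n = comb M (v k) z n"
      by (rule comb_cong) auto
    ultimately show ?thesis
      using r.f_im[OF vk(1)] by (simp add: syz_def)
  qed
  then have "(\<lambda>k. restrict (v k) {..<n}) \<in> {..<h} \<rightarrow> syz R M z n" by auto
  moreover have "s \<odot>\<^bsub>Rn R n\<^esub> a \<in> combs R (Rn R n) (\<lambda>k. restrict (v k) {..<n}) h"
    if a: "a \<in> syz R M z n" for a
  proof -
    have aP: "a \<in> carrier (Rn R n)" "comb M a z n = \<zero>\<^bsub>M\<^esub>" using a by (auto simp: syz_def)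
    have a': "a \<in> {..<n} \<rightarrow> carrier R" using aP by (auto intro: F.Rn_coeff)
    have "comb F a c n \<in> combs R F w l"
      using w(2) F.comb_closed[OF a' cF] pc[OF a'] aP by auto
    then obtain b where b: "b \<in> carrier (Rn R l)" "comb F a c n = comb F b w l"
      unfolding combs_def by blast
    interpret cw: mod_hom R "Rn R l" F "\<lambda>b. comb F b w l" by (rule F.comb_mod_hom[OF w(1)])
    \<comment> \<open>With this sign, \<open>a\<close> followed by \<open>?b\<close> is a syzygy of
      \<open>e\<close>: the two parts cancel.\<close>
    let ?b = "\<ominus>\<^bsub>Rn R l\<^esub> b"
    have b': "?b \<in> carrier (Rn R l)" using b by simp
    then have b'': "?b \<in> {..<l} \<rightarrow> carrier R" by (auto intro: F.Rn_coeff)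
    define d where "d = (\<lambda>i\<in>{..<n + l}. if i < n then a i else ?b (i - n))"
    have dQ: "d \<in> carrier (Rn R (n + l))"
      unfolding d_def by (rule F.restrict_in_Rn) (use aP b' in \<open>auto intro!: F.Rn_coeff\<close>)
    have "comb F d e (n + l) = comb F (\<lambda>i. if i < n then a i else ?b (i - n)) e (n + l)"
      by (rule comb_cong) (auto simp: d_def)
    also have "\<dots> = comb F a c n \<oplus>\<^bsub>F\<^esub> comb F ?b w l"
      unfolding e_def by (rule F.comb_append[OF a' cF b'' w(1)])
    also have "\<dots> = \<zero>\<^bsub>F\<^esub>"
      using b cw.f_neg[OF b(1)] cw.f_im[OF b(1)] by (simp add: F.M.r_neg)
    finally have "d \<in> syz R F e (n + l)" using dQ by (simp add: syz_def)
    then obtain g where g: "g \<in> carrier (Rn R h)" "s \<odot>\<^bsub>Rn R (n + l)\<^esub> d = comb (Rn R (n + l)) g v h"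
      using sv unfolding combs_def by blast
    have g': "g \<in> {..<h} \<rightarrow> carrier R" using g by (auto intro: F.Rn_coeff)
    have "restrict d {..<n} = a"
      by (rule F.Rn_ext[OF r.f_im[OF dQ] aP(1)]) (auto simp: d_def)
    then have "s \<odot>\<^bsub>Rn R n\<^esub> a = restrict (s \<odot>\<^bsub>Rn R (n + l)\<^esub> d) {..<n}"
      using r.f_smult[OF sR dQ] by simp
    also have "\<dots> = comb (Rn R n) g (\<lambda>k. restrict (v k) {..<n}) h"
      unfolding g(2) using r.hom_comb[OF g' vQ] by simp
    also have "\<dots> \<in> combs R (Rn R n) (\<lambda>k. restrict (v k) {..<n}) h"
      by (rule P.comb_in_combs[OF g'])
    finally show ?thesis .
  qed
  ultimately show "S_finite_in R S (Rn R n) (syz R M z n)"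
    unfolding S_finite_in_def using s by blast
qed

text \<open>An injective homomorphism leaves the set of syzygies unchanged. This carries the
  property from a copy of \<open>R\<close> back to \<open>R\<close>.\<close>

lemma syz_S_fin_pullback:
  assumes q: "mod_hom R A N q" and inj: "inj_on q (carrier A)" and N: "syz_S_fin R S N"
  shows "syz_S_fin R S A"
  unfolding syz_S_fin_def
proof (intro allI impI)
  fix n and x :: "nat \<Rightarrow> _" assume x: "x \<in> {..<n} \<rightarrow> carrier A"
  interpret A: module R A using q by (simp add: mod_hom_def)
  interpret q: mod_hom R A N q by fact
  have "comb A c x n = \<zero>\<^bsub>A\<^esub> \<longleftrightarrow> comb N c (\<lambda>i. q (x i)) n = \<zero>\<^bsub>N\<^esub>" if "c \<in> carrier (Rn R n)" for c
  proof -
    have c: "c \<in> {..<n} \<rightarrow> carrier R" using that by (auto intro: A.Rn_coeff)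
    show ?thesis
      using q.hom_comb[OF c x] inj_onD[OF inj, of "comb A c x n" "\<zero>\<^bsub>A\<^esub>"] by auto
  qed
  then have "syz R A x n = syz R N (\<lambda>i. q (x i)) n"
    by (auto simp: syz_def)
  moreover have "(\<lambda>i. q (x i)) \<in> {..<n} \<rightarrow> carrier N" using x by auto
  ultimately show "S_finite_in R S (Rn R n) (syz R A x n)"
    using N unfolding syz_S_fin_def by metis
qed

section \<open>The ring as a module over itself, and its finitely presented modules\<close>

context cring
begin

lemma fin_gen_self_module: "fin_gen_module R (self_module R)"
proof -
  interpret self: module R "self_module R" by (rule self_module_module)
  have "r \<in> combs R (self_module R) (\<lambda>_. \<one>) 1" if "r \<in> carrier R" for r
    using that self.comb_in_combs[of "\<lambda>_. r" 1 "\<lambda>_. \<one>"] by (simp add: self_module_def)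
  moreover have "combs R (self_module R) (\<lambda>_. \<one>) 1 \<subseteq> carrier (self_module R)"
    using self.combs_submodule[of "\<lambda>_. \<one>" 1] by (simp add: submodule_def self_module_def)
  ultimately show ?thesis
    unfolding self.fin_gen_module_iff
    by (intro exI[of _ "\<lambda>_. \<one>"] exI[of _ 1]) (auto simp: self_module_def)
qed

lemma S_coherent_ring_iff:
  "S \<subseteq> carrier R \<Longrightarrow> S_coherent_ring R S \<longleftrightarrow> syz_S_fin R S (self_module R)"
  by (simp add: S_coherent_ring_def module.S_coherent_module_iff[OF self_module_module] fin_gen_self_module)

text \<open>The free module of the presentation supplies finite generators \<open>x\<close> of
  \<open>M\<close>. By Schanuel's lemma with \<open>S = {1}\<close> their syzygies are finitely
  generated, so \<open>M\<close> is a quotient of \<open>Rn R m\<close> by a finitely generated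
  submodule; the property passes from \<open>R\<close> to \<open>Rn R m\<close> and then to
  \<open>M\<close>.\<close>

lemma S_coherent_module_if_finitely_presented:
  assumes S: "S \<subseteq> carrier R" "\<And>s t. s \<in> S \<Longrightarrow> t \<in> S \<Longrightarrow> s \<otimes> t \<in> S"
    and coh: "S_coherent_ring R S" and fp: "finitely_presented R M"
  shows "S_coherent_module R S M"
proof -
  have sfp: "S_finitely_presented R {\<one>} M"
    using fp by (simp only: finitely_presented_iff_S_finitely_presented_one)
  from fp obtain K F :: "('a, nat \<Rightarrow> 'a) module" and f g
    where ex: "short_exact R K F M f g" "fin_gen_free_module R F"
    unfolding finitely_presented_def by blast
  have g: "mod_hom R F M g" using ex by (simp add: short_exact_def)
  then interpret M: module R M by (simp add: mod_hom_def)
  interpret g: mod_hom R F M g by (rule g)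
  have fgF: "fin_gen_module R F"
    using ex(2) unfolding fin_gen_free_module_def fin_gen_module_def by blast
  obtain b m where b: "b \<in> {..<m} \<rightarrow> carrier F" "carrier F = combs R F b m"
    using fgF unfolding g.M.fin_gen_module_iff by blast
  define x where "x = (\<lambda>i. g (b i))"
  have x: "x \<in> {..<m} \<rightarrow> carrier M" using b by (auto simp: x_def)
  have gen: "carrier M = combs R M x m"
  proof -
    have "carrier M = g ` combs R F b m"
      using ex(1) b(2) by (simp add: short_exact_def g.im_def)
    also have "\<dots> = combs R M x m"
      unfolding combs_def image_image x_def
    proof (rule image_cong[OF refl])
      fix c assume "c \<in> carrier (Rn R m)"
      then have "c \<in> {..<m} \<rightarrow> carrier R" by (auto intro: Rn_coeff)
      then show "g (comb F c b m) = comb M c (\<lambda>i. g (b i)) m"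
        using g.hom_comb[OF _ b(1)] by blast
    qed
    finally show ?thesis .
  qed
  interpret P: module R "Rn R m" by (rule Rn_module)
  have "S_finite_in R {\<one>} (Rn R m) (syz R M x m)"
    by (rule M.syz_S_fin_if_S_finitely_presented[OF x gen _ sfp]) simp
  then obtain w l where w: "w \<in> {..<l} \<rightarrow> syz R M x m"
    "\<And>v. v \<in> syz R M x m \<Longrightarrow> \<one> \<odot>\<^bsub>Rn R m\<^esub> v \<in> combs R (Rn R m) w l"
    unfolding S_finite_in_def by blast
  have "combs R (Rn R m) w l \<subseteq> syz R M x m"
    by (rule P.combs_subset_submodule[OF M.syz_submodule[OF x] w(1)])
  moreover have "syz R M x m \<subseteq> combs R (Rn R m) w l"
    using w(2) by (auto simp: syz_def)
  \<comment> \<open>Since the multiplier is one, \<open>w\<close> generates the whole kernel, as the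
    passage to the quotient requires.\<close>
  ultimately have syz: "{c \<in> carrier (Rn R m). comb M c x m = \<zero>\<^bsub>M\<^esub>} = combs R (Rn R m) w l"
    by (simp add: syz_def)
  have "syz_S_fin R S M"
  proof (rule syz_S_fin_quotient[OF S(1) M.comb_mod_hom[OF x] _ _ syz])
    show "(\<lambda>c. comb M c x m) ` carrier (Rn R m) = carrier M"
      using gen by (simp add: combs_def)
    show "w \<in> {..<l} \<rightarrow> carrier (Rn R m)" using w(1) by (auto simp: syz_def)
    show "syz_S_fin R S (Rn R m)"
      using coh unfolding S_coherent_ring_iff[OF S(1)] by (intro syz_S_fin_Rn S)
  qed
  moreover have "fin_gen_module R M"
    unfolding M.fin_gen_module_iff using x gen by blast
  ultimately show ?thesis
    unfolding M.S_coherent_module_iff[OF S(1)] by blast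
qed

text \<open>A copy of \<open>R\<close> over the element type of the modules in the first quantifier of the theorem.\<close>

definition tag :: "'a \<Rightarrow> (nat \<Rightarrow> 'a) set" where
  "tag r = {\<lambda>_. r}"

text \<open>The index 0 is an arbitrary choice, since \<open>tag r\<close> contains only a constant
  function.\<close>

definition untag :: "(nat \<Rightarrow> 'a) set \<Rightarrow> 'a" where
  "untag A = the_elem A 0"

lemma untag_tag [simp]: "untag (tag r) = r"
  by (simp add: tag_def untag_def)

definition self_copy :: "('a, (nat \<Rightarrow> 'a) set) module" where
  "self_copy = \<lparr>carrier = tag ` carrier R, mult = (\<lambda>A B. tag (untag A \<otimes> untag B)), one = tag \<one>,
     zero = tag \<zero>, add = (\<lambda>A B. tag (untag A \<oplus> untag B)), smult = (\<lambda>r A. tag (r \<otimes> untag A))\<rparr>"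

lemma self_copy_module: "module R self_copy"
proof (rule module_criteria)
  show "\<forall>v\<in>carrier self_copy. \<exists>w\<in>carrier self_copy. v \<oplus>\<^bsub>self_copy\<^esub> w = \<zero>\<^bsub>self_copy\<^esub>"
    by (auto simp: self_copy_def intro!: bexI[of _ "\<ominus> _"] arg_cong[of _ _ tag] r_neg)
qed (auto simp: self_copy_def m_assoc l_distr r_distr is_cring a_ac)

lemma tag_hom: "mod_hom R (self_module R) self_copy tag"
  by (rule mod_homI[OF self_module_module self_copy_module]) (auto simp: self_copy_def self_module_def)

text \<open>The single generator \<open>tag \<one>\<close> presents the copy as
  \<open>Rn R 1\<close> modulo zero.\<close>

lemma finitely_presented_self_copy: "finitely_presented R self_copy"
proof -
  interpret U: module R self_copy by (rule self_copy_module)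
  interpret P: module R "Rn R 1" by (rule Rn_module)
  let ?x = "\<lambda>_::nat. tag \<one>"
  have x: "?x \<in> {..<1} \<rightarrow> carrier self_copy" by (auto simp: self_copy_def)
  have comb: "comb self_copy c ?x 1 = tag (c 0)" if "c 0 \<in> carrier R" for c
    using that by (simp add: self_copy_def)
  have "carrier self_copy \<subseteq> combs R self_copy ?x 1"
  proof
    fix A assume "A \<in> carrier self_copy"
    then obtain r where r: "r \<in> carrier R" "A = tag r" by (auto simp: self_copy_def)
    then show "A \<in> combs R self_copy ?x 1"
      using U.comb_in_combs[of "\<lambda>_. r" 1 ?x] comb[of "\<lambda>_. r"] by simp
  qed
  moreover have "combs R self_copy ?x 1 \<subseteq> carrier self_copy"
    using U.combs_submodule[OF x] by (simp add: submodule_def)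
  moreover have "S_finite_in R {\<one>} (Rn R 1) (syz R self_copy ?x 1)"
  proof -
    have zero: "c = \<zero>\<^bsub>Rn R 1\<^esub>" if c: "c \<in> syz R self_copy ?x 1" for c
    proof (rule Rn_ext)
      have cP: "c \<in> carrier (Rn R 1)" using c by (simp add: syz_def)
      then have "tag (c 0) = tag \<zero>"
        using c comb[of c] Rn_coeff[OF cP, of 0] by (simp add: syz_def self_copy_def)
      then have "c 0 = \<zero>" by (metis untag_tag)
      then show "c i = \<zero>\<^bsub>Rn R 1\<^esub> i" if "i < 1" for i
        using that Rn_apply(3)[of i 1] by simp
    qed (use c P.zero_closed in \<open>simp_all only: syz_def mem_Collect_eq\<close>)
    \<comment> \<open>The zero vector is the combination of the empty family, so
      \<open>l = 0\<close> works with any \<open>w\<close>.\<close>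
    have "\<one> \<odot>\<^bsub>Rn R 1\<^esub> c \<in> combs R (Rn R 1) w 0" if "c \<in> syz R self_copy ?x 1" for c w
      using P.comb_in_combs[of "\<lambda>_. \<zero>" 0 w] unfolding zero[OF that] P.smult_one[OF P.zero_closed] by simp
    then show ?thesis
      unfolding S_finite_in_def
      by (intro bexI[of _ \<one>] exI[of _ undefined] exI[of _ 0] conjI ballI) simp_all
  qed
  ultimately show ?thesis
    unfolding finitely_presented_iff_S_finitely_presented_one
    by (intro U.S_finitely_presented_if_syz_S_fin[OF x] equalityI)
qed

end

theorem theorem3:
  fixes R :: "('a, 'r) ring_scheme" and S :: "'a set"
  assumes "cring R"
    and "S \<subseteq> carrier R"
    and "\<And>s t. s \<in> S \<Longrightarrow> t \<in> S \<Longrightarrow> s \<otimes>\<^bsub>R\<^esub> t \<in> S"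
  shows "S_coherent_ring R S \<longleftrightarrow>
    (\<forall>M :: ('a, (nat \<Rightarrow> 'a) set) module. finitely_presented R M \<longrightarrow> S_coherent_module R S M) \<and>
    (\<forall>M :: ('a, 'm) module. finitely_presented R M \<longrightarrow> S_coherent_module R S M)"
proof -
  interpret cring R by fact
  show ?thesis
  proof
    assume "S_coherent_ring R S"
    then show "(\<forall>M :: ('a, (nat \<Rightarrow> 'a) set) module. finitely_presented R M \<longrightarrow> S_coherent_module R S M) \<and>
      (\<forall>M :: ('a, 'm) module. finitely_presented R M \<longrightarrow> S_coherent_module R S M)"
      by (intro conjI allI impI; intro S_coherent_module_if_finitely_presented assms)
  next
    assume "(\<forall>M :: ('a, (nat \<Rightarrow> 'a) set) module. finitely_presented R M \<longrightarrow> S_coherent_module R S M) \<and>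
      (\<forall>M :: ('a, 'm) module. finitely_presented R M \<longrightarrow> S_coherent_module R S M)"
    \<comment> \<open>The hypothesis is tested on the copy of \<open>R\<close>, whose element type
      is that of the first quantifier; injectivity of \<open>tag\<close> then brings the property of
      syzygies back to \<open>R\<close>.\<close>
    then have "S_coherent_module R S self_copy"
      using finitely_presented_self_copy by blast
    then have "syz_S_fin R S self_copy"
      using module.S_coherent_module_iff[OF self_copy_module assms(2)] by blast
    moreover have "inj_on tag (carrier (self_module R))"
      by (rule inj_on_inverseI[where g=untag]) simp
    ultimately have "syz_S_fin R S (self_module R)"
      using syz_S_fin_pullback[OF tag_hom] by blast
    then show "S_coherent_ring R S"
      using S_coherent_ring_iff[OF assms(2)] by blast
  qed
qed

end
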